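(* Let $\hbar>0$, $q=e^{i\pi\hbar}$, let $a_i,b_i,c_i$ ($i=1,\dots,n-1$) be elements of an associative unital algebra over $\mathbb C$, and put $M_i=\begin{pmatrix}qa_i&-b_i\\c_i&-q^{-1}a_i\end{pmatrix}$. Then: (1) for $i<j$, the relations \begin{align*} & q^{-1}b_ib_j=qb_jb_i,\qquad q^{-1}c_ic_j=qc_jc_i,\qquad a_ib_j=b_ja_i,\qquad c_ia_j=a_jc_i,\qquad qc_ib_j=q^{-1}b_jc_i,\\ & b_ia_j=a_jb_i+(q^2-q^{-2})a_ib_j,\qquad a_ic_j=c_ja_i+(q^2-q^{-2})c_ia_j,\\ & a_ia_j=a_ja_i+(1-q^{-2})b_jc_i=a_ja_i+(q^2-1)c_ib_j,\\ & qb_ic_j+q(q^{-2}-q^{2})a_ia_j=q^{-1}c_jb_i-q^{-1}(q^{-2}-q^{2})a_ja_i \end{align*} can be presented in the $R$-matrix form (are equivalent to) $$R_{12}[q^{-1}]\,\overset{1}{M}_i\,R_{12}[q]\,\overset{2}{M}_j=\overset{2}{M}_j\,R_{12}[q^{-1}]\,\overset{1}{M}_i\,R_{12}[q];$$ (2) for each $i$, the relations $qa_ib_i=q^{-1}b_ia_i$, $q^{-1}a_ic_i=qc_ia_i$, $b_ic_i-c_ib_i=(q^2-q^{-2})a_i^2$ can be presented in the $R$-matrix form (are equivalent to) $$R^{T}_{12}[q^{-2}]\,\overset{2}{M}_i\,\overset{1}{M}_i=\overset{1}{M}_i\,\overset{2}{M}_i\,R_{12}[q^{-2}].$$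
   Context: $E_{kl}$ denotes the $2\times 2$ matrix units, and for a nonzero number $t$ $$R_{12}[t]=t(E_{11}\otimes E_{11}+E_{22}\otimes E_{22})+E_{11}\otimes E_{22}+E_{22}\otimes E_{11}+(t-t^{-1})E_{12}\otimes E_{21},$$ acting in $\mathbb C^2\otimes\mathbb C^2$; $R^T_{12}$ is its total transpose, and $R_{12}[t^{-1}]=R_{12}[t]^{-1}$. For a $2\times2$ matrix $M$ with entries in the algebra, $\overset{1}{M}=M\otimes \mathbb E$ and $\overset{2}{M}=\mathbb E\otimes M$, where $\mathbb E$ is the $2\times2$ identity matrix; in products the algebra elements are multiplied in the order of matrix multiplication. *)

theory Defs
  imports "HOL-Analysis.Analysis"
begin

locale complex_algebra = vector_space scaleC
  for scaleC :: "complex \<Rightarrow> 'a::ring_1 \<Rightarrow> 'a" (infixr \<open>*\<^sub>C\<close> 75) +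
  assumes scale_mult_left: "(z *\<^sub>C x) * y = z *\<^sub>C (x * y)"
    and scale_mult_right: "x * (z *\<^sub>C y) = z *\<^sub>C (x * y)"

definition matrix_unit :: "'m \<Rightarrow> 'n \<Rightarrow> 'a::zero_neq_one ^ 'n ^ 'm" where
  "matrix_unit k l = (\<chi> i j. if i = k \<and> j = l then 1 else 0)"

text \<open>The tensor product of matrices: rows and columns of the product are indexed by pairs,
  and entries are multiplied in the order of the tensor factors.\<close>

definition kronecker ::
    "'a::times ^ 'n ^ 'm \<Rightarrow> 'a ^ 'q ^ 'p \<Rightarrow> 'a ^ ('n \<times> 'q) ^ ('m \<times> 'p)"
    (infixr \<open>\<otimes>\<^sub>K\<close> 75) where
  "A \<otimes>\<^sub>K B = (\<chi> i j. A $ fst i $ fst j * B $ snd i $ snd j)"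

definition R_matrix :: "complex \<Rightarrow> complex ^ (2 \<times> 2) ^ (2 \<times> 2)" where
  "R_matrix t =
     map_matrix ((*) t)
       (matrix_unit 1 1 \<otimes>\<^sub>K matrix_unit 1 1 + matrix_unit 2 2 \<otimes>\<^sub>K matrix_unit 2 2)
     + matrix_unit 1 1 \<otimes>\<^sub>K matrix_unit 2 2
     + matrix_unit 2 2 \<otimes>\<^sub>K matrix_unit 1 1
     + map_matrix ((*) (t - inverse t)) (matrix_unit 1 2 \<otimes>\<^sub>K matrix_unit 2 1)"

text \<open>The complex matrix \<open>R\<^sub>1\<^sub>2[t]\<close>, regarded as a matrix over the algebra via the
  unit map \<open>z \<mapsto> z *\<^sub>C 1\<close>.\<close>

definition R12 :: "(complex \<Rightarrow> 'a::ring_1 \<Rightarrow> 'a) \<Rightarrow> complex \<Rightarrow> 'a ^ (2 \<times> 2) ^ (2 \<times> 2)" where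
  "R12 scaleC t = map_matrix (\<lambda>z. scaleC z 1) (R_matrix t)"

definition leg1 :: "'a::ring_1 ^ 2 ^ 2 \<Rightarrow> 'a ^ (2 \<times> 2) ^ (2 \<times> 2)" where
  "leg1 M = M \<otimes>\<^sub>K mat 1"

definition leg2 :: "'a::ring_1 ^ 2 ^ 2 \<Rightarrow> 'a ^ (2 \<times> 2) ^ (2 \<times> 2)" where
  "leg2 M = mat 1 \<otimes>\<^sub>K M"

end

theory Submission
  imports Defs
begin

text \<open>The powers of \<open>q\<close> act as multiplication by central units \<open>Q\<close> and \<open>P\<close> of the algebra, so the
  scalars can be kept in front of the words in the generators. Both the listed relations of part (1)
  and the 16 entries of the \<open>R\<close>-matrix equation amount to nine rules moving the generators with
  index \<open>j\<close> to the left of those with index \<open>i\<close>. Only powers of \<open>q\<close> are inverted, so roots of unity need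
  no separate treatment. In part (2) three of the entries already are the relations up to a unit.\<close>

text \<open>A general ring has no inversion, so the inverse of \<open>t\<close> enters as a second
  argument \<open>s\<close>. The single off-diagonal entry comes from E_12 tensor E_21, whose row is
  \<open>(1, 2)\<close> and whose column is \<open>(2, 1)\<close>.\<close>

definition central_R_matrix :: "'a::ring_1 \<Rightarrow> 'a \<Rightarrow> 'a ^ (2 \<times> 2) ^ (2 \<times> 2)" where
  "central_R_matrix t s = (\<chi> k l.
     if k = l then (if fst k = snd k then t else 1)
     else if k = (1, 2) \<and> l = (2, 1) then t - s else 0)"

lemma (in complex_algebra) R12_eq_central_R_matrix:
  "R12 scaleC t = central_R_matrix (t *\<^sub>C 1) (inverse t *\<^sub>C 1)"
  by (simp add: vec_eq_iff forall_2 split_paired_All R12_def R_matrix_def central_R_matrix_def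
      map_matrix_def matrix_unit_def kronecker_def scale_left_diff_distrib)

lemma matrix_mult_pair_nth:
  fixes A B :: "'a::semiring_1 ^ (2 \<times> 2) ^ (2 \<times> 2)"
  shows "(A ** B) $ k $ l = A $ k $ (1, 1) * B $ (1, 1) $ l + A $ k $ (1, 2) * B $ (1, 2) $ l
    + A $ k $ (2, 1) * B $ (2, 1) $ l + A $ k $ (2, 2) * B $ (2, 2) $ l"
proof -
  have "(A ** B) $ k $ l = (\<Sum>m\<in>UNIV \<times> UNIV. A $ k $ m * B $ m $ l)"
    by (simp add: matrix_matrix_mult_def)
  also have "\<dots> = (\<Sum>i\<in>UNIV. \<Sum>j\<in>UNIV. A $ k $ (i, j) * B $ (i, j) $ l)"
    by (simp add: sum.cartesian_product case_prod_unfold del: UNIV_Times_UNIV)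
  finally show ?thesis
    by (simp add: sum_2 add.assoc)
qed

lemma leg_nth:
  "leg1 M $ (i, j) $ (k, l) = (if j = l then M $ i $ k else 0)"
  "leg2 M $ (i, j) $ (k, l) = (if i = k then M $ j $ l else 0)"
  by (simp_all add: leg1_def leg2_def kronecker_def mat_def)

lemma matrix_pair_eq_iff:
  fixes A B :: "'a ^ (2 \<times> 2) ^ (2 \<times> 2)"
  shows "A = B \<longleftrightarrow> (\<forall>i j k l. A $ (i, j) $ (k, l) = B $ (i, j) $ (k, l))"
  by (simp add: vec_eq_iff split_paired_All)

locale central_unit =
  fixes Q P :: "'a::ring_1"
  assumes central_Q: "x * Q = Q * x" and central_P: "x * P = P * x" and PQ_eq_1: "P * Q = 1"
begin

lemma QP_eq_1: "Q * P = 1" and P_Q_left: "P * (Q * x) = x" and Q_P_left: "Q * (P * x) = x"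
  and central_Q_left: "x * (Q * y) = Q * (x * y)" and central_P_left: "x * (P * y) = P * (x * y)"
proof -
  show 1: "Q * P = 1" using central_P[of Q] PQ_eq_1 by simp
  show "P * (Q * x) = x" by (simp add: mult.assoc[symmetric] PQ_eq_1)
  show "Q * (P * x) = x" by (simp add: mult.assoc[symmetric] 1)
  show "x * (Q * y) = Q * (x * y)" by (metis mult.assoc central_Q)
  show "x * (P * y) = P * (x * y)" by (metis mult.assoc central_P)
qed

context
  fixes a b c a' b' c' :: 'a
begin

text \<open>Here \<open>a, b, c\<close> stand for the generators of index \<open>i\<close> and \<open>a', b', c'\<close> for those of index \<open>j\<close>.\<close>

definition "normal_ordering \<longleftrightarrow>
   b * b' = Q * (Q * (b' * b)) \<and> c * c' = Q * (Q * (c' * c)) \<and> a * b' = b' * a \<and> c * a' = a' * c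
   \<and> c * b' = P * (P * (b' * c))
   \<and> b * a' = a' * b + Q * (Q * (b' * a)) - P * (P * (b' * a))
   \<and> a * c' = c' * a + Q * (Q * (a' * c)) - P * (P * (a' * c))
   \<and> a * a' = a' * a + b' * c - P * (P * (b' * c))
   \<and> b * c' = P * (P * (c' * b)) + Q * (Q * (a' * a)) + a' * a - P * (P * (a' * a))
       - P * (P * (P * (P * (a' * a))))
       + Q * (Q * (b' * c)) - b' * c - P * (P * (b' * c)) + P * (P * (P * (P * (b' * c))))"

text \<open>Centrality is used only at the six generators: for arbitrary \<open>x\<close> the laws
  would also apply to \<open>P\<close> and \<open>Q\<close> themselves and could permute them
  without end. Every product becomes a power of \<open>Q\<close> or of \<open>P\<close> followed by
  a word in the generators.\<close>

lemmas to_front = central_Q[of a] central_Q[of b] central_Q[of c] central_Q[of a'] central_Q[of b']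
  central_Q[of c'] central_P[of a] central_P[of b] central_P[of c] central_P[of a'] central_P[of b']
  central_P[of c'] central_Q_left[of a] central_Q_left[of b] central_Q_left[of c] central_Q_left[of a']
  central_Q_left[of b'] central_Q_left[of c'] central_P_left[of a] central_P_left[of b]
  central_P_left[of c] central_P_left[of a'] central_P_left[of b'] central_P_left[of c']
  PQ_eq_1 QP_eq_1 P_Q_left Q_P_left

text \<open>Ten relations match nine rules because the two formulas for \<open>a * a'\<close> agree
  once \<open>c * b' = P * (P * (b' * c))\<close> holds: (\<open>Q\<close>^2 - 1) \<open>P\<close>^2
  = 1 - \<open>P\<close>^2.\<close>

lemma cross_relations_iff_normal_ordering:
  "normal_ordering \<longleftrightarrow>
     P * (b * b') = Q * (b' * b) \<and> P * (c * c') = Q * (c' * c)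
     \<and> a * b' = b' * a \<and> c * a' = a' * c \<and> Q * (c * b') = P * (b' * c)
     \<and> b * a' = a' * b + (Q * Q - P * P) * (a * b')
     \<and> a * c' = c' * a + (Q * Q - P * P) * (c * a')
     \<and> a * a' = a' * a + (1 - P * P) * (b' * c)
     \<and> a * a' = a' * a + (Q * Q - 1) * (c * b')
     \<and> Q * (b * c') + (Q * (P * P - Q * Q)) * (a * a')
        = P * (c' * b) - (P * (P * P - Q * Q)) * (a' * a)" (is "_ \<longleftrightarrow> ?rels")
proof
  assume n: normal_ordering
  show ?rels
    by (simp add: algebra_simps to_front n[unfolded normal_ordering_def])
next
  assume r: ?rels
  have 1: "a * b' = b' * a" "c * a' = a' * c" "a * a' = a' * a + b' * c - P * (P * (b' * c))"
    using r by (simp_all add: algebra_simps)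
  have 2: "b * b' = Q * (Q * (b' * b))" "c * c' = Q * (Q * (c' * c))" "c * b' = P * (P * (b' * c))"
    using r by (metis P_Q_left Q_P_left)+
  have 3: "b * a' = a' * b + Q * (Q * (b' * a)) - P * (P * (b' * a))"
     "a * c' = c' * a + Q * (Q * (a' * c)) - P * (P * (a' * c))"
    using r by (simp_all add: algebra_simps 1(1,2))
  \<comment> \<open>The last relation is solved for \<open>b * c'\<close>: its left side appears
    here times \<open>P\<close>, so it can be replaced by its right side. The remaining
    \<open>a * a'\<close> is then put in order by its own rule, which produces the terms in
    \<open>b' * c\<close>.\<close>
  have "b * c' = P * (Q * (b * c') + (Q * (P * P - Q * Q)) * (a * a'))
     - P * ((Q * (P * P - Q * Q)) * (a * a'))"
    by (simp add: algebra_simps to_front)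
  also have "\<dots> = P * (P * (c' * b) - (P * (P * P - Q * Q)) * (a' * a))
     - P * ((Q * (P * P - Q * Q)) * (a * a'))"
    using r by (elim conjE) (simp only:)
  finally show normal_ordering
    unfolding normal_ordering_def using 1 2 3 by (simp add: algebra_simps to_front)
qed

lemmas product_entry = matrix_mult_pair_nth leg_nth central_R_matrix_def

text \<open>Nine of the 16 entries yield one rule each. Conversely, the rules turn both sides of
  every entry into the same combination of words with the primed generator first.\<close>

lemma cross_R_equation_iff_normal_ordering:
 "central_R_matrix P Q ** leg1 (vector [vector [Q * a, - b], vector [c, - (P * a)]])
   ** central_R_matrix Q P ** leg2 (vector [vector [Q * a', - b'], vector [c', - (P * a')]])
   = leg2 (vector [vector [Q * a', - b'], vector [c', - (P * a')]]) ** central_R_matrix P Q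
     ** leg1 (vector [vector [Q * a, - b], vector [c, - (P * a)]]) ** central_R_matrix Q P
   \<longleftrightarrow> normal_ordering" (is "?L = ?R \<longleftrightarrow> _")
proof
  assume eq: "?L = ?R"
  \<comment> \<open>The factor \<open>z\<close> is chosen below to cancel the power of
    \<open>Q\<close> or \<open>P\<close> in front of the word to be solved for.\<close>
  have entry: "z * ?L $ k $ l = z * ?R $ k $ l" for z k l
    by (simp only: eq)
  have 1: "a * b' = b' * a" "c * a' = a' * c"
    using entry[of P "(1, 1)" "(1, 2)"] entry[of "P * P" "(2, 1)" "(1, 1)"]
    by (simp_all add: product_entry algebra_simps to_front)
  have 2: "b * b' = Q * (Q * (b' * b))" "c * c' = Q * (Q * (c' * c))" "c * b' = P * (P * (b' * c))"
    using entry[of Q "(1, 1)" "(2, 2)"] entry[of Q "(2, 2)" "(1, 1)"] entry[of P "(2, 1)" "(1, 2)"]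
    by (simp_all add: product_entry algebra_simps to_front)
  have 3: "a * a' = a' * a + b' * c - P * (P * (b' * c))"
    "b * a' = a' * b + Q * (Q * (b' * a)) - P * (P * (b' * a))"
    using entry[of 1 "(2, 1)" "(2, 1)"] entry[of 1 "(1, 1)" "(2, 1)"]
    by (simp_all add: product_entry algebra_simps to_front)
  \<comment> \<open>This entry also contains \<open>c * a'\<close>, and the one for
    \<open>b * c'\<close> contains \<open>a * a'\<close>; the rules already found put these words in
    order.\<close>
  have 4: "a * c' = c' * a + Q * (Q * (a' * c)) - P * (P * (a' * c))"
    using entry[of Q "(2, 2)" "(2, 1)"]
    by (simp add: product_entry algebra_simps to_front 1)
  have 5: "b * c' = P * (P * (c' * b)) + Q * (Q * (a' * a)) + a' * a - P * (P * (a' * a))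
       - P * (P * (P * (P * (a' * a))))
       + Q * (Q * (b' * c)) - b' * c - P * (P * (b' * c)) + P * (P * (P * (P * (b' * c))))"
    using entry[of P "(1, 2)" "(2, 1)"]
    by (simp add: product_entry algebra_simps to_front 3(1))
  show normal_ordering
    unfolding normal_ordering_def using 1 2 3 4 5 by blast
next
  assume n: normal_ordering
  show "?L = ?R"
    unfolding matrix_pair_eq_iff forall_2
    by (simp add: product_entry algebra_simps to_front n[unfolded normal_ordering_def])
qed

lemma single_R_equation_iff:
 "transpose (central_R_matrix (P * P) (Q * Q))
   ** leg2 (vector [vector [Q * a, - b], vector [c, - (P * a)]])
   ** leg1 (vector [vector [Q * a, - b], vector [c, - (P * a)]])
   = leg1 (vector [vector [Q * a, - b], vector [c, - (P * a)]])
   ** leg2 (vector [vector [Q * a, - b], vector [c, - (P * a)]]) ** central_R_matrix (P * P) (Q * Q)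
   \<longleftrightarrow> Q * (a * b) = P * (b * a) \<and> P * (a * c) = Q * (c * a)
     \<and> b * c - c * b = (Q * Q - P * P) * a\<^sup>2" (is "?L = ?R \<longleftrightarrow> ?rels")
proof
  assume eq: "?L = ?R"
  have entry: "?L $ k $ l = ?R $ k $ l" for k l
    by (simp only: eq)
  show ?rels
    using entry[of "(1, 1)" "(1, 2)"] entry[of "(1, 2)" "(1, 1)"] entry[of "(1, 2)" "(2, 1)"]
    by (simp add: product_entry transpose_def power2_eq_square algebra_simps to_front)
next
  assume r: ?rels
  \<comment> \<open>Solved for \<open>b * a\<close>, \<open>a * c\<close> and \<open>b * c\<close>,
    the relations put \<open>c\<close> before \<open>a\<close> before \<open>b\<close> in every word
    of length two, and then both sides agree entrywise.\<close>
  have 1: "b * a = Q * (Q * (a * b))"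
    using r by (metis Q_P_left)
  have 2: "a * c = Q * (Q * (c * a))"
    using r by (metis Q_P_left)
  have 3: "b * c = c * b + Q * (Q * (a * a)) - P * (P * (a * a))"
    using r by (simp add: power2_eq_square algebra_simps)
  show "?L = ?R"
    unfolding matrix_pair_eq_iff forall_2
    by (simp add: product_entry transpose_def algebra_simps to_front 1 2 3)
qed

end
end

theorem mainTheorem6:
  fixes scaleC :: "complex \<Rightarrow> 'a::ring_1 \<Rightarrow> 'a" (infixr \<open>*\<^sub>C\<close> 75)
    and h :: real and q :: complex and n :: nat
    and a b c :: "nat \<Rightarrow> 'a" and M :: "nat \<Rightarrow> 'a ^ 2 ^ 2"
  assumes algebra: "complex_algebra scaleC"
    and h_pos: "h > 0"
    and q_eq: "q = exp (\<i> * complex_of_real (pi * h))"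
    and M_eq: "\<And>i. i \<in> {1..<n} \<Longrightarrow>
      M i = vector [vector [q *\<^sub>C a i, - b i],
                    vector [c i, - (q powi -1 *\<^sub>C a i)]]"
  shows
    "(\<forall>i\<in>{1..<n}. \<forall>j\<in>{1..<n}. i < j \<longrightarrow>
        ((q powi -1 *\<^sub>C (b i * b j) = q *\<^sub>C (b j * b i)
          \<and> q powi -1 *\<^sub>C (c i * c j) = q *\<^sub>C (c j * c i)
          \<and> a i * b j = b j * a i
          \<and> c i * a j = a j * c i
          \<and> q *\<^sub>C (c i * b j) = q powi -1 *\<^sub>C (b j * c i)
          \<and> b i * a j = a j * b i + (q powi 2 - q powi -2) *\<^sub>C (a i * b j)
          \<and> a i * c j = c j * a i + (q powi 2 - q powi -2) *\<^sub>C (c i * a j)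
          \<and> a i * a j = a j * a i + (1 - q powi -2) *\<^sub>C (b j * c i)
          \<and> a i * a j = a j * a i + (q powi 2 - 1) *\<^sub>C (c i * b j)
          \<and> q *\<^sub>C (b i * c j) + (q * (q powi -2 - q powi 2)) *\<^sub>C (a i * a j)
             = q powi -1 *\<^sub>C (c j * b i)
               - (q powi -1 * (q powi -2 - q powi 2)) *\<^sub>C (a j * a i))
         \<longleftrightarrow>
         R12 scaleC (q powi -1) ** leg1 (M i) ** R12 scaleC q ** leg2 (M j)
         = leg2 (M j) ** R12 scaleC (q powi -1) ** leg1 (M i) ** R12 scaleC q))
     \<and>
     (\<forall>i\<in>{1..<n}.
        (q *\<^sub>C (a i * b i) = q powi -1 *\<^sub>C (b i * a i)
         \<and> q powi -1 *\<^sub>C (a i * c i) = q *\<^sub>C (c i * a i)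
         \<and> b i * c i - c i * b i = (q powi 2 - q powi -2) *\<^sub>C (a i ^ 2))
        \<longleftrightarrow>
        transpose (R12 scaleC (q powi -2)) ** leg2 (M i) ** leg1 (M i)
        = leg1 (M i) ** leg2 (M i) ** R12 scaleC (q powi -2))"

proof -
  interpret complex_algebra scaleC by (rule algebra)
  have q: "q \<noteq> 0" by (simp add: q_eq)
  \<comment> \<open>The unit map of the algebra is multiplicative with central image, so it turns
    scalar multiplication into ring multiplication and makes \<open>u q\<close> and
    \<open>u (inverse q)\<close> mutually inverse central elements.\<close>
  define u where "u z = z *\<^sub>C (1::'a)" for z
  have scale: "z *\<^sub>C x = u z * x" for z x
    by (simp add: u_def scale_mult_left)
  have central: "x * u z = u z * x" for z x
    by (simp add: u_def scale_mult_left scale_mult_right)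
  have u_mult: "u (z * w) = u z * u w" for z w
    by (simp add: u_def scale_mult_left)
  have u_diff: "u (z - w) = u z - u w" for z w
    by (simp add: u_def scale_left_diff_distrib)
  have u_1: "u 1 = 1"
    by (simp add: u_def)
  define Q P where "Q = u q" and "P = u (inverse q)"
  interpret central_unit Q P
  proof
    show "x * Q = Q * x" "x * P = P * x" for x
      by (simp_all only: Q_def P_def central)
    show "P * Q = 1"
      using u_mult[of "inverse q" q] by (simp add: Q_def P_def q u_1)
  qed
  have powi: "q powi 2 = q * q" "q powi -1 = inverse q" "q powi -2 = inverse q * inverse q"
    by (simp_all add: power_int_def power2_eq_square)
  note u_simps = u_mult u_diff u_1 Q_def[symmetric] P_def[symmetric]
  have R: "R12 scaleC q = central_R_matrix Q P" "R12 scaleC (inverse q) = central_R_matrix P Q"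
     "R12 scaleC (inverse q * inverse q) = central_R_matrix (P * P) (Q * Q)"
    by (simp_all add: R12_eq_central_R_matrix flip: u_def) (simp_all add: u_simps)
  have M: "M i = vector [vector [Q * a i, - b i], vector [c i, - (P * a i)]]" if "i \<in> {1..<n}" for i
    using M_eq[OF that] by (simp only: scale powi Q_def P_def)
  show ?thesis
    by (intro conjI ballI impI)
      (simp_all only: powi R M scale u_simps single_R_equation_iff
        cross_R_equation_iff_normal_ordering cross_relations_iff_normal_ordering)
qed

end
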